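(* Let $A$ be an associative algebra, $M$ an $A$-bimodule, $H$ a Hochschild $2$-cocycle of $A$ with coefficients in $M$, and $T:M\to A$ an $H$-twisted Rota-Baxter operator. Then the cohomology $\mathcal H^\bullet_T(M,A)$ of $T$ is isomorphic to the Hochschild cohomology $H^\bullet_{\mathrm{Hoch}}(M,A)$ of the associative algebra $(M,* )$ with coefficients in the $(M,* )$-bimodule $A$, where $u*v=u\cdot T(v)+T(u)\cdot v+H(Tu,Tv)$ and the left and right actions of $M$ on $A$ are $$l_T(u,a)=T(u)a-T(u\cdot a+H(Tu,a)),\qquad r_T(a,u)=aT(u)-T(a\cdot u+H(a,Tu)).$$
   Context: All vector spaces, linear maps and tensor products are over a field $\mathbb K$ of characteristic $0$. Let $A$ be an associative algebra with product $\mu(a,b)=ab$. An $A$-bimodule is a vector space $M$ with bilinear left and right actions $l(a,u)=a\cdot u$, $r(u,a)=u\cdot a$ satisfying $(ab)\cdot u=a\cdot(b\cdot u)$, $(a\cdot u)\cdot b=a\cdot(u\cdot b)$, $(u\cdot a)\cdot b=u\cdot(ab)$. A Hochschild $2$-cocycle is a bilinear map $H:A^{\otimes 2}\to M$ with $a\cdot H(b,c)-H(ab,c)+H(a,bc)-H(a,b)\cdot c=0$. A linear map $T:M\to A$ is an $H$-twisted Rota-Baxter operator if $T(u)T(v)=T(u\cdot T(v)+T(u)\cdot v+H(Tu,Tv))$ for all $u,v\in M$. Cohomology of $T$. Let $V=A\oplus M$ and regard multilinear maps on $A$ and $M$ as multilinear maps on $V$, extended by zero; $\mathrm{Hom}(M^{\otimes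 0},A)=A$. For $f\in\mathrm{Hom}(V^{\otimes m},V)$, $g\in\mathrm{Hom}(V^{\otimes n},V)$ the Gerstenhaber bracket is $[f,g]_{\mathsf G}=f\circ g-(-1)^{(m-1)(n-1)}g\circ f$, where $f\circ g=\sum_{i=1}^m(-1)^{(i-1)(n-1)}f\circ_i g$ and $f\circ_i g$ inserts $g$ in the $i$-th input of $f$. Here $\mu+l+r$ is $((a,u),(b,v))\mapsto(ab,a\cdot v+u\cdot b)$ and $H$ is $((a,u),(b,v))\mapsto(0,H(a,b))$. For $P,Q,R$ of arities $p,q,r$ (maps $M^{\otimes p}\to A$, etc.), $$\llbracket P,Q\rrbracket=(-1)^p[[\mu+l+r,P]_{\mathsf G},Q]_{\mathsf G},\qquad \llbracket P,Q,R\rrbracket=(-1)^{q+1}[[[H,P]_{\mathsf G},Q]_{\mathsf G},R]_{\mathsf G},$$ and $d_T:\mathrm{Hom}(M^{\otimes n},A)\to\mathrm{Hom}(M^{\otimes n+1},A)$ is the differential $d_T(f)=\llbracket T,f\rrbracket-\frac12\llbracket T,T,f\rrbracket$. Then $\mathcal Z^n_T(M,A)=\{f\in\mathrm{Hom}(M^{\otimes n},A): d_Tf=0\}$, $\mathcal B^n_T(M,A)=\{d_Tg: g\in\mathrm{Hom}(M^{\otimes n-1},A)\}$ (with $\mathcal B^0_T=0$), and $\mathcal H^n_T(M,A)=\mathcal Z^n_T(M,A)/\mathcal B^n_T(M,A)$, $n\ge0$. Hochschild cohomology of $(M,* )$ with coefficients in $A$ is that of the complex $\mathrm{Hom}(M^{\otimes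 n},A)$, $n\ge 0$, with $$(\delta_{\mathrm{Hoch}}f)(u_1,\ldots,u_{n+1})=l_T(u_1,f(u_2,\ldots,u_{n+1}))+\sum_{i=1}^n(-1)^if(u_1,\ldots,u_i*u_{i+1},\ldots,u_{n+1})+(-1)^{n+1}r_T(f(u_1,\ldots,u_n),u_{n+1}).$$ *)

theory Defs
  imports Complex_Main "HOL-Library.Product_Plus" "HOL-Library.Function_Algebras"
begin

section \<open>Associative algebras, bimodules, twisted Rota-Baxter operators\<close>

text \<open>
  Vector spaces over the field \<open>'k\<close> are given by a scalar multiplication satisfying the locale
  \<^locale>\<open>vector_space\<close>. Algebras are not assumed to be unital.
\<close>

definition bilinear_map ::
  "('k::field \<Rightarrow> 'a::ab_group_add \<Rightarrow> 'a) \<Rightarrow> ('k \<Rightarrow> 'b::ab_group_add \<Rightarrow> 'b) \<Rightarrow>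
   ('k \<Rightarrow> 'c::ab_group_add \<Rightarrow> 'c) \<Rightarrow> ('a \<Rightarrow> 'b \<Rightarrow> 'c) \<Rightarrow> bool" where
  "bilinear_map s1 s2 s3 f \<longleftrightarrow>
     (\<forall>x. Vector_Spaces.linear s2 s3 (\<lambda>y. f x y)) \<and>
     (\<forall>y. Vector_Spaces.linear s1 s3 (\<lambda>x. f x y))"

locale assoc_algebra = vector_space scaleA
  for scaleA :: "'k::field \<Rightarrow> 'a::ab_group_add \<Rightarrow> 'a" +
  fixes mu :: "'a \<Rightarrow> 'a \<Rightarrow> 'a"
  assumes mu_bilinear: "bilinear_map scaleA scaleA scaleA mu"
    and mu_assoc: "mu (mu a b) c = mu a (mu b c)"

locale bimodule = A: assoc_algebra scaleA mu + M: vector_space scaleM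
  for scaleA :: "'k::field \<Rightarrow> 'a::ab_group_add \<Rightarrow> 'a" and mu :: "'a \<Rightarrow> 'a \<Rightarrow> 'a"
    and scaleM :: "'k \<Rightarrow> 'm::ab_group_add \<Rightarrow> 'm" +
  fixes l :: "'a \<Rightarrow> 'm \<Rightarrow> 'm" and r :: "'m \<Rightarrow> 'a \<Rightarrow> 'm"
  assumes l_bilinear: "bilinear_map scaleA scaleM scaleM l"
    and r_bilinear: "bilinear_map scaleM scaleA scaleM r"
    and l_l: "l (mu a b) u = l a (l b u)"
    and l_r: "r (l a u) b = l a (r u b)"
    and r_r: "r (r u a) b = r u (mu a b)"

locale hochschild_2_cocycle = bimodule scaleA mu scaleM l r
  for scaleA :: "'k::field \<Rightarrow> 'a::ab_group_add \<Rightarrow> 'a" and mu :: "'a \<Rightarrow> 'a \<Rightarrow> 'a"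
    and scaleM :: "'k \<Rightarrow> 'm::ab_group_add \<Rightarrow> 'm"
    and l :: "'a \<Rightarrow> 'm \<Rightarrow> 'm" and r :: "'m \<Rightarrow> 'a \<Rightarrow> 'm" +
  fixes H :: "'a \<Rightarrow> 'a \<Rightarrow> 'm"
  assumes H_bilinear: "bilinear_map scaleA scaleA scaleM H"
    and H_cocycle: "l a (H b c) - H (mu a b) c + H a (mu b c) - r (H a b) c = 0"

definition twisted_product ::
  "('a \<Rightarrow> 'm \<Rightarrow> 'm) \<Rightarrow> ('m \<Rightarrow> 'a \<Rightarrow> 'm) \<Rightarrow> ('a \<Rightarrow> 'a \<Rightarrow> 'm) \<Rightarrow> ('m \<Rightarrow> 'a) \<Rightarrow>
   'm \<Rightarrow> 'm \<Rightarrow> 'm::ab_group_add" where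
  "twisted_product l r H T u v = r u (T v) + l (T u) v + H (T u) (T v)"

locale twisted_rota_baxter = hochschild_2_cocycle scaleA mu scaleM l r H
  for scaleA :: "'k::field \<Rightarrow> 'a::ab_group_add \<Rightarrow> 'a" and mu :: "'a \<Rightarrow> 'a \<Rightarrow> 'a"
    and scaleM :: "'k \<Rightarrow> 'm::ab_group_add \<Rightarrow> 'm"
    and l :: "'a \<Rightarrow> 'm \<Rightarrow> 'm" and r :: "'m \<Rightarrow> 'a \<Rightarrow> 'm" and H :: "'a \<Rightarrow> 'a \<Rightarrow> 'm" +
  fixes T :: "'m \<Rightarrow> 'a"
  assumes T_linear: "Vector_Spaces.linear scaleM scaleA T"
    and T_twisted: "mu (T u) (T v) = T (r u (T v) + l (T u) v + H (T u) (T v))"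

definition twisted_left_action ::
  "('a \<Rightarrow> 'a \<Rightarrow> 'a) \<Rightarrow> ('m \<Rightarrow> 'a \<Rightarrow> 'm) \<Rightarrow> ('a \<Rightarrow> 'a \<Rightarrow> 'm) \<Rightarrow> ('m \<Rightarrow> 'a) \<Rightarrow>
   'm::ab_group_add \<Rightarrow> 'a \<Rightarrow> 'a::ab_group_add" where
  "twisted_left_action mu r H T u a = mu (T u) a - T (r u a + H (T u) a)"

definition twisted_right_action ::
  "('a \<Rightarrow> 'a \<Rightarrow> 'a) \<Rightarrow> ('a \<Rightarrow> 'm \<Rightarrow> 'm) \<Rightarrow> ('a \<Rightarrow> 'a \<Rightarrow> 'm) \<Rightarrow> ('m \<Rightarrow> 'a) \<Rightarrow>
   'a \<Rightarrow> 'm::ab_group_add \<Rightarrow> 'a::ab_group_add" where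
  "twisted_right_action mu l H T a u = mu a (T u) - T (l a u + H a (T u))"


section \<open>Multilinear maps and the Gerstenhaber bracket\<close>

text \<open>
  An $n$-ary map is a function on lists that is $0$ off the lists of length $n$, so that each
  multilinear map has exactly one representative. In arity $0$ it is determined by its arbitrary
  value at \<open>[]\<close>, i.e. $\mathrm{Hom}(M^{\otimes 0},A)=A$.
\<close>

definition multilinear_maps ::
  "('k::field \<Rightarrow> 'm::ab_group_add \<Rightarrow> 'm) \<Rightarrow> ('k \<Rightarrow> 'a::ab_group_add \<Rightarrow> 'a) \<Rightarrow> nat \<Rightarrow>
   ('m list \<Rightarrow> 'a) set" where
  "multilinear_maps scaleM scaleA n =
     {f. (\<forall>us. length us \<noteq> n \<longrightarrow> f us = 0) \<and>
         (\<forall>us ws. length us + length ws + 1 = n \<longrightarrow>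
            Vector_Spaces.linear scaleM scaleA (\<lambda>u. f (us @ u # ws)))}"

definition scale_fun :: "('k \<Rightarrow> 'a \<Rightarrow> 'a) \<Rightarrow> 'k \<Rightarrow> ('x \<Rightarrow> 'a) \<Rightarrow> 'x \<Rightarrow> 'a" where
  "scale_fun s c f = (\<lambda>x. s c (f x))"

definition prod_scale :: "('k \<Rightarrow> 'a \<Rightarrow> 'a) \<Rightarrow> ('k \<Rightarrow> 'm \<Rightarrow> 'm) \<Rightarrow> 'k \<Rightarrow> 'a \<times> 'm \<Rightarrow> 'a \<times> 'm" where
  "prod_scale scaleA scaleM c v = (scaleA c (fst v), scaleM c (snd v))"

text \<open>
  \<open>insertion n i f g\<close> is $f\circ_i g$ for $g$ of arity $n$; as in the usual notation, the inputs of
  $f$ are numbered from $1$, whereas list positions are numbered from $0$.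
\<close>

definition insertion :: "nat \<Rightarrow> nat \<Rightarrow> ('v list \<Rightarrow> 'v) \<Rightarrow> ('v list \<Rightarrow> 'v) \<Rightarrow> 'v list \<Rightarrow> 'v" where
  "insertion n i f g vs =
     f (take (i - 1) vs @ [g (take n (drop (i - 1) vs))] @ drop (i - 1 + n) vs)"

text \<open>
  Here \<open>m\<close> and \<open>n\<close> are the arities of \<open>f\<close> and \<open>g\<close>. Exponents of signs are computed in the integers,
  since $n-1$ is $-1$ for $n=0$.
\<close>

definition gerst_circ ::
  "('k::field \<Rightarrow> 'v::ab_group_add \<Rightarrow> 'v) \<Rightarrow> nat \<Rightarrow> nat \<Rightarrow>
   ('v list \<Rightarrow> 'v) \<Rightarrow> ('v list \<Rightarrow> 'v) \<Rightarrow> 'v list \<Rightarrow> 'v" where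
  "gerst_circ s m n f g vs =
     (if length vs + 1 = m + n
      then \<Sum>i=1..m. s ((-1) powi ((int i - 1) * (int n - 1))) (insertion n i f g vs)
      else 0)"

definition gerst_bracket ::
  "('k::field \<Rightarrow> 'v::ab_group_add \<Rightarrow> 'v) \<Rightarrow> nat \<Rightarrow> nat \<Rightarrow>
   ('v list \<Rightarrow> 'v) \<Rightarrow> ('v list \<Rightarrow> 'v) \<Rightarrow> 'v list \<Rightarrow> 'v" where
  "gerst_bracket s m n f g =
     gerst_circ s m n f g
     - scale_fun s ((-1) powi ((int m - 1) * (int n - 1))) (gerst_circ s n m g f)"

section \<open>The differential of a twisted Rota-Baxter operator\<close>

definition extend_map :: "('m list \<Rightarrow> 'a) \<Rightarrow> ('a \<times> 'm) list \<Rightarrow> 'a \<times> 'm::zero" where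
  "extend_map f vs = (f (map snd vs), 0)"

definition restrict_map_V :: "(('a::zero \<times> 'm) list \<Rightarrow> 'a \<times> 'm) \<Rightarrow> 'm list \<Rightarrow> 'a" where
  "restrict_map_V F us = fst (F (map (\<lambda>u. (0, u)) us))"

definition unary_map :: "('m \<Rightarrow> 'a) \<Rightarrow> 'm list \<Rightarrow> 'a::zero" where
  "unary_map T us = (case us of [u] \<Rightarrow> T u | _ \<Rightarrow> 0)"

text \<open>The binary maps $\mu+l+r$ and $H$ on $V=A\oplus M$.\<close>

definition semidirect_map ::
  "('a \<Rightarrow> 'a \<Rightarrow> 'a) \<Rightarrow> ('a \<Rightarrow> 'm \<Rightarrow> 'm) \<Rightarrow> ('m \<Rightarrow> 'a \<Rightarrow> 'm) \<Rightarrow>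
   ('a \<times> 'm) list \<Rightarrow> 'a::ab_group_add \<times> 'm::ab_group_add" where
  "semidirect_map mu l r vs =
     (case vs of [(a, u), (b, v)] \<Rightarrow> (mu a b, l a v + r u b) | _ \<Rightarrow> 0)"

definition cocycle_map ::
  "('a \<Rightarrow> 'a \<Rightarrow> 'm) \<Rightarrow> ('a \<times> 'm) list \<Rightarrow> 'a::ab_group_add \<times> 'm::ab_group_add" where
  "cocycle_map H vs = (case vs of [(a, u), (b, v)] \<Rightarrow> (0, H a b) | _ \<Rightarrow> 0)"

text \<open>
  The derived brackets, for arbitrary maps \<open>P\<close>, \<open>Q\<close>, \<open>R\<close> on $V$ of arities \<open>p\<close>, \<open>q\<close>, \<open>t\<close>; the binary
  map \<open>w\<close> is to be $\mu+l+r$, and \<open>h\<close> is to be $H$. The bracket of maps of arities $m$ and $n$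
  has arity $m+n-1$.
\<close>

definition derived_bracket2 ::
  "('k::field \<Rightarrow> 'v::ab_group_add \<Rightarrow> 'v) \<Rightarrow> ('v list \<Rightarrow> 'v) \<Rightarrow> nat \<Rightarrow> nat \<Rightarrow>
   ('v list \<Rightarrow> 'v) \<Rightarrow> ('v list \<Rightarrow> 'v) \<Rightarrow> 'v list \<Rightarrow> 'v" where
  "derived_bracket2 s w p q P Q =
     scale_fun s ((-1) ^ p) (gerst_bracket s (p + 1) q (gerst_bracket s 2 p w P) Q)"

definition derived_bracket3 ::
  "('k::field \<Rightarrow> 'v::ab_group_add \<Rightarrow> 'v) \<Rightarrow> ('v list \<Rightarrow> 'v) \<Rightarrow> nat \<Rightarrow> nat \<Rightarrow> nat \<Rightarrow>
   ('v list \<Rightarrow> 'v) \<Rightarrow> ('v list \<Rightarrow> 'v) \<Rightarrow> ('v list \<Rightarrow> 'v) \<Rightarrow> 'v list \<Rightarrow> 'v" where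
  "derived_bracket3 s h p q t P Q R =
     scale_fun s ((-1) ^ (q + 1))
       (gerst_bracket s (p + q) t (gerst_bracket s (p + 1) q (gerst_bracket s 2 p h P) Q) R)"

definition rb_differential_V ::
  "('k::field_char_0 \<Rightarrow> 'a::ab_group_add \<Rightarrow> 'a) \<Rightarrow> ('a \<Rightarrow> 'a \<Rightarrow> 'a) \<Rightarrow>
   ('k \<Rightarrow> 'm::ab_group_add \<Rightarrow> 'm) \<Rightarrow> ('a \<Rightarrow> 'm \<Rightarrow> 'm) \<Rightarrow> ('m \<Rightarrow> 'a \<Rightarrow> 'm) \<Rightarrow>
   ('a \<Rightarrow> 'a \<Rightarrow> 'm) \<Rightarrow> ('m \<Rightarrow> 'a) \<Rightarrow> nat \<Rightarrow> ('m list \<Rightarrow> 'a) \<Rightarrow>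
   ('a \<times> 'm) list \<Rightarrow> 'a \<times> 'm" where
  "rb_differential_V scaleA mu scaleM l r H T n f =
     (let s = prod_scale scaleA scaleM; T' = extend_map (unary_map T); f' = extend_map f in
        derived_bracket2 s (semidirect_map mu l r) 1 n T' f'
        - scale_fun s (1 / 2) (derived_bracket3 s (cocycle_map H) 1 1 n T' T' f'))"

text \<open>
  The brackets above are maps on $V$. The lemma \<open>extend_map_rb_differential\<close> below shows
  that the result is the extension by zero of a map on $M$ with values in $A$, so that passing to
  that map loses nothing.
\<close>

definition rb_differential ::
  "('k::field_char_0 \<Rightarrow> 'a::ab_group_add \<Rightarrow> 'a) \<Rightarrow> ('a \<Rightarrow> 'a \<Rightarrow> 'a) \<Rightarrow>
   ('k \<Rightarrow> 'm::ab_group_add \<Rightarrow> 'm) \<Rightarrow> ('a \<Rightarrow> 'm \<Rightarrow> 'm) \<Rightarrow> ('m \<Rightarrow> 'a \<Rightarrow> 'm) \<Rightarrow>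
   ('a \<Rightarrow> 'a \<Rightarrow> 'm) \<Rightarrow> ('m \<Rightarrow> 'a) \<Rightarrow> nat \<Rightarrow> ('m list \<Rightarrow> 'a) \<Rightarrow> 'm list \<Rightarrow> 'a" where
  "rb_differential scaleA mu scaleM l r H T n f =
     restrict_map_V (rb_differential_V scaleA mu scaleM l r H T n f)"

section \<open>The Hochschild differential\<close>

text \<open>
  For an algebra with product \<open>m\<close> and a bimodule with scalar multiplication \<open>s\<close> and
  actions \<open>l\<close>, \<open>r\<close>. Since lists are indexed from $0$, the pair $u_i,u_{i+1}$ is
  \<open>us ! (i - 1)\<close>, \<open>us ! i\<close>.
\<close>

definition hochschild_differential ::
  "('k::field \<Rightarrow> 'a::ab_group_add \<Rightarrow> 'a) \<Rightarrow> ('m \<Rightarrow> 'm \<Rightarrow> 'm) \<Rightarrow> ('m \<Rightarrow> 'a \<Rightarrow> 'a) \<Rightarrow>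
   ('a \<Rightarrow> 'm \<Rightarrow> 'a) \<Rightarrow> nat \<Rightarrow> ('m list \<Rightarrow> 'a) \<Rightarrow> 'm list \<Rightarrow> 'a" where
  "hochschild_differential s m l r n f us =
     (if length us = n + 1
      then l (hd us) (f (tl us))
           + (\<Sum>i=1..n. s ((-1) ^ i)
                (f (take (i - 1) us @ [m (us ! (i - 1)) (us ! i)] @ drop (i + 1) us)))
           + s ((-1) ^ (n + 1)) (r (f (butlast us)) (last us))
      else 0)"

section \<open>Cohomology\<close>

definition cocycles :: "(nat \<Rightarrow> 'x set) \<Rightarrow> (nat \<Rightarrow> 'x \<Rightarrow> 'x::zero) \<Rightarrow> nat \<Rightarrow> 'x set" where
  "cocycles C d n = {f \<in> C n. d n f = 0}"

definition coboundaries :: "(nat \<Rightarrow> 'x set) \<Rightarrow> (nat \<Rightarrow> 'x \<Rightarrow> 'x::zero) \<Rightarrow> nat \<Rightarrow> 'x set" where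
  "coboundaries C d n = (case n of 0 \<Rightarrow> {0} | Suc k \<Rightarrow> d k ` C k)"

text \<open>
  The quotient of a subspace \<open>Z\<close> by a subspace \<open>B\<close> is the set of cosets of \<open>B\<close> with the operations
  induced from representatives. For \<open>c = 0\<close> the product of a coset by \<open>c\<close> is \<open>B\<close>, which would not
  be the case for the elementwise product.
\<close>

definition coset :: "'x::ab_group_add set \<Rightarrow> 'x \<Rightarrow> 'x set" where
  "coset B x = {x + b | b. b \<in> B}"

definition quotient_space :: "'x::ab_group_add set \<Rightarrow> 'x set \<Rightarrow> 'x set set" where
  "quotient_space Z B = coset B ` Z"

definition quotient_add :: "'x::ab_group_add set \<Rightarrow> 'x set \<Rightarrow> 'x set \<Rightarrow> 'x set" where
  "quotient_add B X Y = (\<Union>x\<in>X. \<Union>y\<in>Y. coset B (x + y))"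

definition quotient_scale ::
  "('k \<Rightarrow> 'x \<Rightarrow> 'x) \<Rightarrow> 'x::ab_group_add set \<Rightarrow> 'k \<Rightarrow> 'x set \<Rightarrow> 'x set" where
  "quotient_scale s B c X = (\<Union>x\<in>X. coset B (s c x))"

definition quotient_isomorphic ::
  "('k \<Rightarrow> 'x::ab_group_add \<Rightarrow> 'x) \<Rightarrow> 'x set \<Rightarrow> 'x set \<Rightarrow>
   ('k \<Rightarrow> 'y::ab_group_add \<Rightarrow> 'y) \<Rightarrow> 'y set \<Rightarrow> 'y set \<Rightarrow> bool" where
  "quotient_isomorphic s Z B s' Z' B' \<longleftrightarrow>
     (\<exists>\<phi>. bij_betw \<phi> (quotient_space Z B) (quotient_space Z' B') \<and>
       (\<forall>X\<in>quotient_space Z B. \<forall>Y\<in>quotient_space Z B.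
          \<phi> (quotient_add B X Y) = quotient_add B' (\<phi> X) (\<phi> Y)) \<and>
       (\<forall>c. \<forall>X\<in>quotient_space Z B.
          \<phi> (quotient_scale s B c X) = quotient_scale s' B' c (\<phi> X)))"

text \<open>Isomorphism, in every degree, of the cohomologies of two complexes.\<close>

definition cohomology_isomorphic ::
  "('k \<Rightarrow> 'x::ab_group_add \<Rightarrow> 'x) \<Rightarrow> (nat \<Rightarrow> 'x set) \<Rightarrow> (nat \<Rightarrow> 'x \<Rightarrow> 'x) \<Rightarrow>
   ('k \<Rightarrow> 'y::ab_group_add \<Rightarrow> 'y) \<Rightarrow> (nat \<Rightarrow> 'y set) \<Rightarrow> (nat \<Rightarrow> 'y \<Rightarrow> 'y) \<Rightarrow> bool" where
  "cohomology_isomorphic s C d s' C' d' \<longleftrightarrow>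
     (\<forall>n. quotient_isomorphic s (cocycles C d n) (coboundaries C d n)
                              s' (cocycles C' d' n) (coboundaries C' d' n))"

section \<open>Well-posedness\<close>

lemma bilinear_mapD:
  assumes "bilinear_map s1 s2 s3 f"
  shows "f (x + x') y = f x y + f x' y" "f x (y + y') = f x y + f x y'"
    "f (x - x') y = f x y - f x' y" "f x (y - y') = f x y - f x y'"
    "f (s1 c x) y = s3 c (f x y)" "f x (s2 c y) = s3 c (f x y)"
    "f 0 y = 0" "f x 0 = 0"
proof -
  interpret R: Vector_Spaces.linear s2 s3 "\<lambda>y. f x y" for x
    using assms unfolding bilinear_map_def by blast
  interpret L: Vector_Spaces.linear s1 s3 "\<lambda>x. f x y" for y
    using assms unfolding bilinear_map_def by blast
  show "f (x + x') y = f x y + f x' y" "f x (y + y') = f x y + f x y'"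
    "f (x - x') y = f x y - f x' y" "f x (y - y') = f x y - f x y'"
    "f (s1 c x) y = s3 c (f x y)" "f x (s2 c y) = s3 c (f x y)"
    "f 0 y = 0" "f x 0 = 0"
    by (rule L.add R.add L.diff R.diff L.scale R.scale L.zero R.zero)+
qed

lemma bilinear_mapI:
  assumes "vector_space s1" "vector_space s2" "vector_space s3"
    and "\<And>x x' y. f (x + x') y = f x y + f x' y" "\<And>x y y'. f x (y + y') = f x y + f x y'"
    and "\<And>c x y. f (s1 c x) y = s3 c (f x y)" "\<And>c x y. f x (s2 c y) = s3 c (f x y)"
  shows "bilinear_map s1 s2 s3 f"
  using assms unfolding bilinear_map_def Vector_Spaces.linear_iff by simp

context twisted_rota_baxter
begin

lemmas bilin = bilinear_mapD[OF A.mu_bilinear] bilinear_mapD[OF l_bilinear]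
  bilinear_mapD[OF r_bilinear] bilinear_mapD[OF H_bilinear]

lemma T_simps: "T (u + v) = T u + T v" "T (u - v) = T u - T v" "T 0 = 0"
  "T (scaleM c u) = scaleA c (T u)"
proof -
  interpret T: Vector_Spaces.linear scaleM scaleA T by (rule T_linear)
  show "T (u + v) = T u + T v" "T (u - v) = T u - T v" "T 0 = 0"
    "T (scaleM c u) = scaleA c (T u)"
    by (rule T.add T.diff T.zero T.scale)+
qed

abbreviation star where "star \<equiv> twisted_product l r H T"
abbreviation lT where "lT \<equiv> twisted_left_action mu r H T"
abbreviation rT where "rT \<equiv> twisted_right_action mu l H T"

lemma T_star: "T (star u v) = mu (T u) (T v)"
  by (simp add: T_twisted twisted_product_def)

lemma H_cocycle': "l a (H b c) + H a (mu b c) = H (mu a b) c + r (H a b) c"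
  using H_cocycle[of a b c] by (simp add: algebra_simps)

lemma star_assoc: "star (star u v) w = star u (star v w)"
proof -
  have "star (star u v) w = r (star u v) (T w) + l (mu (T u) (T v)) w + H (mu (T u) (T v)) (T w)"
    by (simp add: twisted_product_def[of l r H T "star u v" w] T_star)
  moreover have "star u (star v w) = r u (mu (T v) (T w)) + l (T u) (star v w) + H (T u) (mu (T v) (T w))"
    by (simp add: twisted_product_def[of l r H T u "star v w"] T_star)
  ultimately show ?thesis
    using H_cocycle'[of "T u" "T v" "T w"]
    by (simp add: twisted_product_def bilin l_l l_r r_r algebra_simps)
qed

lemma twisted_assoc_algebra: "assoc_algebra scaleM star"
proof
  show "bilinear_map scaleM scaleM scaleM star"
    by (rule bilinear_mapI)
      (simp_all add: M.vector_space_axioms twisted_product_def bilin T_simps algebra_simps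
        M.scale_right_distrib)
qed (rule star_assoc)

lemma twisted_bimodule: "bimodule scaleM star scaleA lT rT"
proof -
  interpret MA: assoc_algebra scaleM star by (rule twisted_assoc_algebra)
  show ?thesis
  proof
    show "bilinear_map scaleM scaleA scaleA lT"
      by (rule bilinear_mapI)
        (simp_all add: M.vector_space_axioms A.vector_space_axioms twisted_left_action_def bilin
          T_simps algebra_simps A.scale_right_distrib A.scale_right_diff_distrib)
    show "bilinear_map scaleA scaleM scaleA rT"
      by (rule bilinear_mapI)
        (simp_all add: M.vector_space_axioms A.vector_space_axioms twisted_right_action_def bilin
          T_simps algebra_simps A.scale_right_distrib A.scale_right_diff_distrib)
  next
    fix u v a
    have "T (l (T u) (H (T v) a)) + T (H (T u) (mu (T v) a))
        = T (H (mu (T u) (T v)) a) + T (r (H (T u) (T v)) a)"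
      by (metis H_cocycle' T_simps(1))
    moreover have "mu (T u) (T x) = T (r u (T x)) + T (l (T u) x) + T (H (T u) (T x))"
      if "x \<in> {r v a, H (T v) a}" for x
      by (simp add: T_twisted T_simps)
    ultimately show "lT (star u v) a = lT u (lT v a)"
      by (simp add: twisted_left_action_def T_star)
        (simp add: twisted_product_def bilin T_simps A.mu_assoc l_l l_r r_r algebra_simps)
  next
    fix u a v
    have c: "T (l (T u) (H a (T v))) + T (H (T u) (mu a (T v)))
        = T (H (mu (T u) a) (T v)) + T (r (H (T u) a) (T v))"
      by (metis H_cocycle' T_simps(1))
    have 1: "mu (T u) (T x) = T (r u (T x)) + T (l (T u) x) + T (H (T u) (T x))" for x
      by (simp add: T_twisted T_simps)
    have 2: "mu (T x) (T v) = T (r x (T v)) + T (l (T x) v) + T (H (T x) (T v))" for x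
      by (simp add: T_twisted T_simps)
    show "rT (lT u a) v = lT u (rT a v)"
      using c
      by (simp add: twisted_left_action_def twisted_right_action_def bilin T_simps A.mu_assoc
          l_l l_r r_r 1 2 algebra_simps)
  next
    fix a u v
    have "T (l a (H (T u) (T v))) + T (H a (mu (T u) (T v)))
        = T (H (mu a (T u)) (T v)) + T (r (H a (T u)) (T v))"
      by (metis H_cocycle' T_simps(1))
    moreover have "mu (T x) (T v) = T (r x (T v)) + T (l (T x) v) + T (H (T x) (T v))"
      if "x \<in> {l a u, H a (T u)}" for x
      by (simp add: T_twisted T_simps)
    ultimately show "rT (rT a u) v = rT a (star u v)"
      by (simp add: twisted_right_action_def T_star)
        (simp add: twisted_product_def bilin T_simps A.mu_assoc[symmetric] l_l l_r r_r algebra_simps)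
  qed
qed

lemma prod_scale_simps:
  "prod_scale scaleA scaleM c (x, y) = (scaleA c x, scaleM c y)"
  "prod_scale scaleA scaleM c 0 = 0"
  "prod_scale scaleA scaleM 1 p = p"
  "prod_scale scaleA scaleM (-1) p = - p"
  by (simp_all add: prod_scale_def zero_prod_def uminus_prod_def)

abbreviation vanishing_extension :: "(('a \<times> 'm) list \<Rightarrow> 'a \<times> 'm) \<Rightarrow> bool" where
  "vanishing_extension F \<equiv> extend_map (restrict_map_V F) = F"

lemma vanishing_extensionI:
  assumes "\<And>vs. F vs = F (map (\<lambda>u. (0, u)) (map snd vs))" "\<And>vs. snd (F vs) = 0"
  shows "vanishing_extension F"
proof
  fix vs show "extend_map (restrict_map_V F) vs = F vs"
    unfolding extend_map_def restrict_map_V_def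
    by (rule prod_eqI) (use assms[of vs] in simp_all)
qed

lemma vanishing_extensionD:
  assumes "vanishing_extension F"
  shows "F vs = F (map (\<lambda>u. (0, u)) (map snd vs))" "snd (F vs) = 0"
proof -
  have eq: "F ws = extend_map (restrict_map_V F) ws" for ws using assms by simp
  show "snd (F vs) = 0" by (simp add: eq extend_map_def)
  show "F vs = F (map (\<lambda>u. (0, u)) (map snd vs))"
    unfolding eq[of vs] eq[of "map (\<lambda>u. (0, u)) (map snd vs)"] by (simp add: extend_map_def comp_def)
qed

lemma vanishing_extension_diff:
  assumes "vanishing_extension F" "vanishing_extension G"
  shows "vanishing_extension (F - G)"
proof (rule vanishing_extensionI)
  fix vs
  show "(F - G) vs = (F - G) (map (\<lambda>u. (0, u)) (map snd vs))"
    using vanishing_extensionD(1)[OF assms(1), of vs] vanishing_extensionD(1)[OF assms(2), of vs]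
    by simp
  show "snd ((F - G) vs) = 0"
    using vanishing_extensionD(2)[OF assms(1), of vs] vanishing_extensionD(2)[OF assms(2), of vs]
    by simp
qed

lemma vanishing_extension_scale:
  assumes "vanishing_extension F"
  shows "vanishing_extension (scale_fun (prod_scale scaleA scaleM) c F)"
proof (rule vanishing_extensionI)
  fix vs
  show "scale_fun (prod_scale scaleA scaleM) c F vs
      = scale_fun (prod_scale scaleA scaleM) c F (map (\<lambda>u. (0, u)) (map snd vs))"
    using vanishing_extensionD(1)[OF assms, of vs] by (simp add: scale_fun_def)
  show "snd (scale_fun (prod_scale scaleA scaleM) c F vs) = 0"
    using vanishing_extensionD(2)[OF assms, of vs] by (simp add: scale_fun_def prod_scale_def)
qed

lemma vanishing_extension_circ:
  assumes "\<And>i vs. length vs + 1 = p + q \<Longrightarrow> i \<in> {1..p} \<Longrightarrow>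
      insertion q i F G vs = insertion q i F G (map (\<lambda>u. (0, u)) (map snd vs))"
    and "\<And>i vs. length vs + 1 = p + q \<Longrightarrow> i \<in> {1..p} \<Longrightarrow> snd (insertion q i F G vs) = 0"
  shows "vanishing_extension (gerst_circ (prod_scale scaleA scaleM) p q F G)"
proof (rule vanishing_extensionI)
  fix vs
  show "gerst_circ (prod_scale scaleA scaleM) p q F G vs =
      gerst_circ (prod_scale scaleA scaleM) p q F G (map (\<lambda>u. (0, u)) (map snd vs))"
    using assms(1)[of vs] by (auto simp: gerst_circ_def intro!: sum.cong)
  show "snd (gerst_circ (prod_scale scaleA scaleM) p q F G vs) = 0"
    using assms(2)[of vs]
    by (auto simp: gerst_circ_def prod_scale_def snd_sum intro!: sum.neutral)
qed

lemma vanishing_extension_bracket: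
  assumes 1: "\<And>x v. G [(x, 0), v] = G [(x, 0), (0, snd v)]" "\<And>x v. snd (G [(x, 0), v]) = 0"
    and 2: "\<And>x v. G [v, (x, 0)] = G [(0, snd v), (x, 0)]" "\<And>x v. snd (G [v, (x, 0)]) = 0"
    and 3: "\<And>v w. snd (G [v, w]) = snd (G [(0, snd v), (0, snd w)])"
  shows "vanishing_extension (gerst_bracket (prod_scale scaleA scaleM) 2 n G (extend_map f))"
  unfolding gerst_bracket_def
proof (intro vanishing_extension_diff vanishing_extension_scale)
  show "vanishing_extension (gerst_circ (prod_scale scaleA scaleM) 2 n G (extend_map f))"
  proof (rule vanishing_extension_circ)
    fix i :: nat and vs :: "('a \<times> 'm) list"
    assume len: "length vs + 1 = 2 + n" and i: "i \<in> {1..2}"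
    let ?ws = "map (\<lambda>u. (0, u)) (map snd vs) :: ('a \<times> 'm) list"
    obtain v vs' where v: "vs = v # vs'" "length vs' = n" using len by (cases vs) auto
    obtain w vs'' where w: "vs = vs'' @ [w]" "length vs'' = n"
      using len by (cases vs rule: rev_cases) auto
    have i': "i = 1 \<or> i = 2" using i by auto
    have "insertion n 1 G (extend_map f) vs = G [(f (map snd vs''), 0), w]"
      "insertion n 1 G (extend_map f) ?ws = G [(f (map snd vs''), 0), (0, snd w)]"
      using w by (simp_all add: insertion_def extend_map_def comp_def)
    moreover have "insertion n 2 G (extend_map f) vs = G [v, (f (map snd vs'), 0)]"
      "insertion n 2 G (extend_map f) ?ws = G [(0, snd v), (f (map snd vs'), 0)]"
      using v by (simp_all add: insertion_def extend_map_def comp_def)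
    ultimately show "insertion n i G (extend_map f) vs = insertion n i G (extend_map f) ?ws"
      "snd (insertion n i G (extend_map f) vs) = 0"
      using i' 1 2 by metis+
  qed
  show "vanishing_extension (gerst_circ (prod_scale scaleA scaleM) n 2 (extend_map f) G)"
  proof (rule vanishing_extension_circ)
    fix i :: nat and vs :: "('a \<times> 'm) list"
    assume len: "length vs + 1 = n + 2" and i: "i \<in> {1..n}"
    have "length (take 2 (drop (i - 1) vs)) = 2" using len i by auto
    moreover have "\<exists>v w. xs = [v, w]" if "length xs = 2" for xs :: "('a \<times> 'm) list"
      using that by (auto simp: numeral_2_eq_2 length_Suc_conv)
    ultimately obtain v w where vw: "take 2 (drop (i - 1) vs) = [v, w]"
      by blast
    have "take 2 (drop (i - 1) (map (\<lambda>u. (0, u)) (map snd vs)))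
        = map (\<lambda>u. (0, u)) (map snd (take 2 (drop (i - 1) vs)))"
      by (simp add: take_map drop_map)
    then have vw': "take 2 (drop (i - 1) (map (\<lambda>u. (0, u)) (map snd vs)))
        = [(0, snd v), (0, snd w)]"
      by (simp only: vw list.map)
    show "insertion 2 i (extend_map f) G vs
        = insertion 2 i (extend_map f) G (map (\<lambda>u. (0, u)) (map snd vs))"
      unfolding insertion_def extend_map_def vw vw'
      using 3[of v w] by (simp add: take_map drop_map comp_def)
    show "snd (insertion 2 i (extend_map f) G vs) = 0"
      by (simp add: insertion_def extend_map_def)
  qed
qed

lemma bracket_unary:
  "gerst_bracket (prod_scale scaleA scaleM) 2 1 G (extend_map (unary_map T)) [v, w]
   = G [(T (snd v), 0), w] + G [v, (T (snd w), 0)] - (T (snd (G [v, w])), 0)"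
  by (simp add: gerst_bracket_def gerst_circ_def insertion_def extend_map_def
      unary_map_def scale_fun_def prod_scale_simps numeral_2_eq_2)

lemma semidirect_bracket:
  "gerst_bracket (prod_scale scaleA scaleM) 2 1 (semidirect_map mu l r)
     (extend_map (unary_map T)) [v, w]
   = (mu (T (snd v)) (fst w) + mu (fst v) (T (snd w)) - T (l (fst v) (snd w) + r (snd v) (fst w)),
      l (T (snd v)) (snd w) + r (snd v) (T (snd w)))"
  unfolding bracket_unary
  by (cases v; cases w) (simp add: semidirect_map_def bilin)

lemma cocycle_bracket:
  "gerst_bracket (prod_scale scaleA scaleM) 2 1 (cocycle_map H)
     (extend_map (unary_map T)) [v, w]
   = (- T (H (fst v) (fst w)), H (T (snd v)) (fst w) + H (fst v) (T (snd w)))"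
  unfolding bracket_unary
  by (cases v; cases w) (simp add: cocycle_map_def bilin)

lemma cocycle_bracket_bracket:
  "gerst_bracket (prod_scale scaleA scaleM) 2 1
     (gerst_bracket (prod_scale scaleA scaleM) 2 1 (cocycle_map H) (extend_map (unary_map T)))
     (extend_map (unary_map T)) [v, w]
   = (- T (H (T (snd v)) (fst w)) - T (H (fst v) (T (snd w)))
      - T (H (T (snd v)) (fst w) + H (fst v) (T (snd w))),
      H (T (snd v)) (T (snd w)) + H (T (snd v)) (T (snd w)))"
  unfolding bracket_unary[of "gerst_bracket _ _ _ _ _"] cocycle_bracket
  by (simp add: bilin T_simps)

end

lemma extend_map_rb_differential:
  fixes scaleA :: "'k::field_char_0 \<Rightarrow> 'a::ab_group_add \<Rightarrow> 'a"
    and scaleM :: "'k \<Rightarrow> 'm::ab_group_add \<Rightarrow> 'm"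
  assumes "twisted_rota_baxter scaleA mu scaleM l r H T"
  shows "extend_map (rb_differential scaleA mu scaleM l r H T n f)
    = rb_differential_V scaleA mu scaleM l r H T n f"
proof -
  interpret twisted_rota_baxter scaleA mu scaleM l r H T by (rule assms)
  show ?thesis
    unfolding rb_differential_def rb_differential_V_def Let_def derived_bracket2_def
      derived_bracket3_def one_add_one
    by (intro vanishing_extension_diff vanishing_extension_scale vanishing_extension_bracket)
      (simp_all add: semidirect_bracket cocycle_bracket_bracket bilin T_simps del: One_nat_def)
qed

end

(* On Hom(M^n, A) the two differentials differ only by the sign (-1)^n: the bracket with mu+l+r
   contributes the terms of the Hochschild differential that do not involve H, and -1/2 times the
   bracket with H contributes the others. So both complexes have the same cocycles and the same
   coboundaries. *)

theory Submission
  imports Defs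
begin

text \<open>Only parity matters, and \<open>x - 1\<close> and \<open>x + 1\<close> have the same
  parity. This trades the integer exponents, negative when an arity is 0, for natural ones.\<close>

lemma powi_eq_power_minus_one:
  "(-1 :: 'k::field) powi ((int i - 1) * (int n - 1)) = (-1) ^ ((i + 1) * (n + 1))"
  by (auto simp: power_int_minus_left minus_one_power_iff)

lemma quotient_isomorphic_refl: "quotient_isomorphic s Z B s Z B"
  unfolding quotient_isomorphic_def by (rule exI[of _ id]) simp

text \<open>A degreewise sign changes neither kernels nor, since each \<open>C n\<close> is closed
  under negation, images. The two quotients are then equal, and the identity is the
  isomorphism.\<close>

lemma cohomology_isomorphicI_sign:
  fixes C :: "nat \<Rightarrow> 'x::ab_group_add set"
  assumes uminus_closed: "\<And>n f. f \<in> C n \<Longrightarrow> - f \<in> C n"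
    and uminus_d: "\<And>n f. f \<in> C n \<Longrightarrow> d' n (- f) = - d' n f"
    and sign: "\<And>n f. f \<in> C n \<Longrightarrow> d n f = (if even n then d' n f else - d' n f)"
  shows "cohomology_isomorphic s C d s C d'"
proof -
  have "cocycles C d n = cocycles C d' n" for n
    by (auto simp: cocycles_def sign split: if_splits)
  moreover have "d n ` C n = d' n ` C n" for n
  proof (cases "even n")
    case True
    then show ?thesis by (simp add: sign)
  next
    case False
    \<comment> \<open>In odd degree the sign moves from the value to the argument, where negation
      permutes \<open>C n\<close>.\<close>
    then have "d n ` C n = d' n ` uminus ` C n"
      by (auto simp: image_image sign uminus_d)
    also have "uminus ` C n = C n"
    proof
      show "uminus ` C n \<subseteq> C n" by (auto simp: uminus_closed)
      show "C n \<subseteq> uminus ` C n"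
      proof
        fix f assume "f \<in> C n"
        then show "f \<in> uminus ` C n"
          using uminus_closed by (intro image_eqI[of _ _ "- f"]) simp_all
      qed
    qed
    finally show ?thesis .
  qed
  then have "coboundaries C d n = coboundaries C d' n" for n
    by (simp add: coboundaries_def split: nat.split)
  ultimately show ?thesis
    by (simp add: cohomology_isomorphic_def quotient_isomorphic_refl)
qed

lemma multilinear_maps_add:
  assumes "f \<in> multilinear_maps s t n" "length us + length ws + 1 = n"
  shows "f (us @ (x + y) # ws) = f (us @ x # ws) + f (us @ y # ws)"
  using assms by (simp add: multilinear_maps_def Vector_Spaces.linear_iff)

lemma multilinear_maps_uminus:
  assumes "f \<in> multilinear_maps s t n"
  shows "- f \<in> multilinear_maps s t n"
proof -
  have "Vector_Spaces.linear s t (\<lambda>u. - g u)" if "Vector_Spaces.linear s t g" for g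
  proof -
    interpret g: Vector_Spaces.linear s t g by (rule that)
    show ?thesis
      using that by (simp add: Vector_Spaces.linear_iff g.vs2.scale_minus_right)
  qed
  then show ?thesis
    using assms by (auto simp: multilinear_maps_def)
qed

context twisted_rota_baxter
begin

text \<open>Evaluation of a bracket on elements of \<open>M\<close> for any binary \<open>G\<close>
  on the direct sum. The first two terms come from inserting \<open>f\<close> into the two slots of
  \<open>G\<close>, the sum from inserting \<open>G\<close> into \<open>f\<close>. With the factor
  \<open>(-1) ^ (n + 1)\<close> pulled out, the inner signs are those of the Hochschild
  differential.\<close>

lemma gerst_bracket_extend_map:
  fixes G :: "('a \<times> 'm) list \<Rightarrow> 'a \<times> 'm"
  assumes "length us = n + 1"
  shows "fst (gerst_bracket (prod_scale scaleA scaleM) 2 n G (extend_map f)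
             (map (\<lambda>u. (0, u)) us))
    = fst (G [(f (butlast us), 0), (0, last us)])
      + scaleA ((-1) ^ (n + 1)) (fst (G [(0, hd us), (f (tl us), 0)])
          + (\<Sum>i=1..n. scaleA ((-1) ^ i)
              (f (take (i - 1) us @ [snd (G [(0, us ! (i - 1)), (0, us ! i)])] @ drop (i + 1) us))))"
proof -
  let ?z = "map (\<lambda>u. (0::'a, u)) us"
  let ?s = "prod_scale scaleA scaleM"
  let ?g = "\<lambda>i. f (take (i - 1) us @ [snd (G [(0, us ! (i - 1)), (0, us ! i)])] @ drop (i + 1) us)"
  obtain v us' where v: "us = v # us'" "length us' = n"
    using assms by (cases us) auto
  obtain w us'' where w: "us = us'' @ [w]" "length us'' = n"
    using assms by (cases us rule: rev_cases) auto
  have 1: "insertion n 1 G (extend_map f) ?z = G [(f (butlast us), 0), (0, last us)]"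
    using w by (simp add: insertion_def extend_map_def comp_def)
  have 2: "insertion n 2 G (extend_map f) ?z = G [(0, hd us), (f (tl us), 0)]"
    using v by (simp add: insertion_def extend_map_def comp_def)
  \<comment> \<open>The extension of \<open>f\<close> reads only \<open>M\<close>-components and
    takes values in \<open>A\<close>, so only \<open>snd\<close> of the value of \<open>G\<close>
    enters.\<close>
  have ins: "insertion 2 i (extend_map f) G ?z = (?g i, 0)" if "i \<in> {1..n}" for i
  proof -
    have "take 2 (drop (i - 1) us) = [us ! (i - 1), us ! i]"
      using that assms
      by (auto simp: numeral_2_eq_2 take_Suc_conv_app_nth)
    then have "take 2 (drop (i - 1) ?z) = [(0, us ! (i - 1)), (0, us ! i)]"
      by (simp add: drop_map take_map)
    \<comment> \<open>Subtraction is truncated, so \<open>i \<ge> 1\<close> is essential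
      here.\<close>
    moreover have "i - 1 + 2 = i + 1" using that by auto
    ultimately show ?thesis
      by (simp add: insertion_def extend_map_def take_map drop_map comp_def)
  qed
  have "gerst_circ ?s 2 n G (extend_map f) ?z
      = G [(f (butlast us), 0), (0, last us)]
        + ?s ((-1) ^ (n + 1)) (G [(0, hd us), (f (tl us), 0)])"
  proof -
    have two: "{1..2::nat} = {1, 2}" by auto
    show ?thesis
      using assms unfolding gerst_circ_def powi_eq_power_minus_one two
      by (simp add: 1[unfolded One_nat_def] 2 prod_scale_simps power_mult)
  qed
  moreover have "fst (gerst_circ ?s n 2 (extend_map f) G ?z)
      = (\<Sum>i=1..n. scaleA ((-1) ^ (i + 1)) (?g i))"
  proof -
    have "fst (gerst_circ ?s n 2 (extend_map f) G ?z)
      = (\<Sum>i=1..n. fst (?s ((-1) ^ ((i + 1) * (2 + 1))) (insertion 2 i (extend_map f) G ?z)))"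
      using assms unfolding gerst_circ_def powi_eq_power_minus_one
      by (simp add: fst_sum)
    also have "\<dots> = (\<Sum>i=1..n. scaleA ((-1) ^ (i + 1)) (?g i))"
      by (rule sum.cong) (simp_all add: ins prod_scale_simps minus_one_power_iff)
    finally show ?thesis .
  qed
  moreover have "(-1) powi ((int 2 - 1) * (int n - 1)) = (-1 :: 'k) ^ (n + 1)"
    by (simp add: power_int_minus_left minus_one_power_iff)
  ultimately show ?thesis
    by (simp add: gerst_bracket_def scale_fun_def prod_scale_def sum_negf
        A.scale_right_distrib)
qed

lemma hochschild_differential_uminus:
  "hochschild_differential scaleA star lT rT n (- f)
    = - hochschild_differential scaleA star lT rT n f"
proof -
  \<comment> \<open>The roles are swapped: \<open>M\<close> is the algebra and \<open>A\<close> the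
    module, so \<open>l_bilinear\<close> and \<open>r_bilinear\<close> now speak of
    \<open>lT\<close> and \<open>rT\<close>.\<close>
  interpret bimodule scaleM star scaleA lT rT by (rule twisted_bimodule)
  \<comment> \<open>Negation is read off from additivity in the form of the difference
    \<open>0 - a\<close>.\<close>
  have "lT u (- a) = - lT u a" "rT (- a) u = - rT a u" for u a
    using bilinear_mapD(4)[OF l_bilinear, of u 0 a] bilinear_mapD(3)[OF r_bilinear, of 0 a u]
    by (simp_all add: bilinear_mapD(7,8)[OF l_bilinear] bilinear_mapD(7,8)[OF r_bilinear])
  then show ?thesis
    by (intro ext) (simp add: hochschild_differential_def sum_negf A.scale_right_diff_distrib)
qed

end

text \<open>The \<open>-1\<close> in front of the binary derived bracket, and the \<open>-1\<close>
  of \<open>-1/2\<close> in front of the ternary one, combine with the factor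
  \<open>(-1) ^ (n + 1)\<close> of \<open>gerst_bracket_extend_map\<close> to give
  \<open>(-1) ^ n\<close>.\<close>

lemma rb_differential_eq_hochschild_differential:
  fixes scaleA :: "'k::field_char_0 \<Rightarrow> 'a::ab_group_add \<Rightarrow> 'a"
    and scaleM :: "'k \<Rightarrow> 'm::ab_group_add \<Rightarrow> 'm"
  assumes "twisted_rota_baxter scaleA mu scaleM l r H T"
    and f: "f \<in> multilinear_maps scaleM scaleA n"
  shows "rb_differential scaleA mu scaleM l r H T n f
    = scale_fun scaleA ((-1) ^ n)
        (hochschild_differential scaleA (twisted_product l r H T)
          (twisted_left_action mu r H T) (twisted_right_action mu l H T) n f)"
proof
  fix us :: "'m list"
  interpret twisted_rota_baxter scaleA mu scaleM l r H T by (rule assms)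
  let ?s = "prod_scale scaleA scaleM"
  let ?T = "extend_map (unary_map T)"
  let ?G = "gerst_bracket ?s 2 1 (semidirect_map mu l r) ?T"
  let ?K = "gerst_bracket ?s 2 1 (gerst_bracket ?s 2 1 (cocycle_map H) ?T) ?T"
  let ?z = "map (\<lambda>u. (0::'a, u)) us"
  let ?f = "\<lambda>i x. f (take (i - 1) us @ [x] @ drop (i + 1) us)"
  let ?u = "\<lambda>i. us ! (i - 1)" and ?v = "\<lambda>i. us ! i"
  \<comment> \<open>As \<open>T\<close> has arity 1, the prefactors of the derived brackets are
    \<open>(-1) ^ 1\<close> and \<open>(-1) ^ (1 + 1)\<close>.\<close>
  have rb: "rb_differential scaleA mu scaleM l r H T n f us
      = - fst (gerst_bracket ?s 2 n ?G (extend_map f) ?z)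
        - scaleA (1 / 2) (fst (gerst_bracket ?s 2 n ?K (extend_map f) ?z))"
    unfolding rb_differential_def rb_differential_V_def Let_def restrict_map_V_def
      derived_bracket2_def derived_bracket3_def one_add_one
    by (simp add: scale_fun_def prod_scale_def)
  show "rb_differential scaleA mu scaleM l r H T n f us
    = scale_fun scaleA ((-1) ^ n) (hochschild_differential scaleA star lT rT n f) us"
  proof (cases "length us = n + 1")
    case False
    then show ?thesis
      unfolding rb
      by (simp add: scale_fun_def hochschild_differential_def gerst_bracket_def gerst_circ_def
          prod_scale_def)
  next
    case True
    have half: "scaleA (1 / 2) (a + a) = a" for a
      by (simp add: A.scale_right_distrib A.scale_left_distrib[symmetric])
    \<comment> \<open>This additivity in the \<open>i\<close>-th slot is what multilinearity of
      \<open>f\<close> supplies.\<close>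
    have add: "?f i (x + y) = ?f i x + ?f i y" if "i \<in> {1..n}" for i x y
      using that True multilinear_maps_add[OF f, of "take (i - 1) us" "drop (i + 1) us" x y]
      by auto
    have G: "fst (gerst_bracket ?s 2 n ?G (extend_map f) ?z)
      = mu (f (butlast us)) (T (last us)) - T (l (f (butlast us)) (last us))
        + scaleA ((-1) ^ (n + 1)) (mu (T (hd us)) (f (tl us)) - T (r (hd us) (f (tl us)))
          + (\<Sum>i=1..n. scaleA ((-1) ^ i) (?f i (l (T (?u i)) (?v i) + r (?u i) (T (?v i))))))"
      unfolding gerst_bracket_extend_map[OF True] semidirect_bracket
      by (simp add: bilin T_simps)
    \<comment> \<open>Bracketing \<open>H\<close> twice with the same \<open>T\<close> produces
      every term twice; the factor \<open>1/2\<close> removes the repetition.\<close>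
    have K: "scaleA (1 / 2) (fst (gerst_bracket ?s 2 n ?K (extend_map f) ?z))
      = - T (H (f (butlast us)) (T (last us)))
        + scaleA ((-1) ^ (n + 1)) (- T (H (T (hd us)) (f (tl us)))
          + (\<Sum>i=1..n. scaleA ((-1) ^ i) (?f i (H (T (?u i)) (T (?v i))))))"
    proof -
      have "(\<Sum>i=1..n. scaleA ((-1) ^ i) (?f i (H (T (?u i)) (T (?v i)) + H (T (?u i)) (T (?v i)))))
        = (\<Sum>i=1..n. scaleA ((-1) ^ i) (?f i (H (T (?u i)) (T (?v i)))))
          + (\<Sum>i=1..n. scaleA ((-1) ^ i) (?f i (H (T (?u i)) (T (?v i)))))"
        unfolding sum.distrib[symmetric]
        by (intro sum.cong refl) (simp only: add A.scale_right_distrib)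
      then have "fst (gerst_bracket ?s 2 n ?K (extend_map f) ?z)
        = (let x = - T (H (f (butlast us)) (T (last us)))
        + scaleA ((-1) ^ (n + 1)) (- T (H (T (hd us)) (f (tl us)))
          + (\<Sum>i=1..n. scaleA ((-1) ^ i) (?f i (H (T (?u i)) (T (?v i)))))) in x + x)"
        unfolding gerst_bracket_extend_map[OF True] cocycle_bracket_bracket
        by (simp add: bilin T_simps A.scale_right_distrib A.scale_right_diff_distrib Let_def
            algebra_simps)
      then show ?thesis by (simp only: Let_def half)
    qed
    \<comment> \<open>The product \<open>star\<close> splits inside \<open>f\<close> into the part
      seen by \<open>?G\<close> and the part with \<open>H\<close> seen by
      \<open>?K\<close>.\<close>
    have "(\<Sum>i=1..n. scaleA ((-1) ^ i) (?f i (star (?u i) (?v i))))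
      = (\<Sum>i=1..n. scaleA ((-1) ^ i) (?f i (l (T (?u i)) (?v i) + r (?u i) (T (?v i)))))
        + (\<Sum>i=1..n. scaleA ((-1) ^ i) (?f i (H (T (?u i)) (T (?v i)))))"
      unfolding sum.distrib[symmetric] twisted_product_def
      by (intro sum.cong refl) (simp only: add A.scale_right_distrib ac_simps)
    then have "hochschild_differential scaleA star lT rT n f us
      = mu (T (hd us)) (f (tl us)) - T (r (hd us) (f (tl us))) - T (H (T (hd us)) (f (tl us)))
        + ((\<Sum>i=1..n. scaleA ((-1) ^ i) (?f i (l (T (?u i)) (?v i) + r (?u i) (T (?v i)))))
          + (\<Sum>i=1..n. scaleA ((-1) ^ i) (?f i (H (T (?u i)) (T (?v i))))))
        + scaleA ((-1) ^ (n + 1)) (mu (f (butlast us)) (T (last us))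
            - T (l (f (butlast us)) (last us)) - T (H (f (butlast us)) (T (last us))))"
      using True
      by (simp only: hochschild_differential_def twisted_left_action_def twisted_right_action_def
          T_simps simp_thms if_True diff_diff_eq)
    then show ?thesis
      unfolding rb G K scale_fun_def
      \<comment> \<open>Fixing the parity of \<open>n\<close> turns every outer sign into 1 or -1,
        and the terms of \<open>G\<close> and \<open>K\<close> match.\<close>
      by (cases "even n") (simp_all add: algebra_simps)
  qed
qed

theorem theorem3p5:
  fixes scaleA :: "'k::field_char_0 \<Rightarrow> 'a::ab_group_add \<Rightarrow> 'a"
    and mu :: "'a \<Rightarrow> 'a \<Rightarrow> 'a"
    and scaleM :: "'k \<Rightarrow> 'm::ab_group_add \<Rightarrow> 'm"
    and l :: "'a \<Rightarrow> 'm \<Rightarrow> 'm" and r :: "'m \<Rightarrow> 'a \<Rightarrow> 'm"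
    and H :: "'a \<Rightarrow> 'a \<Rightarrow> 'm" and T :: "'m \<Rightarrow> 'a"
  assumes "assoc_algebra scaleA mu"
    and "bimodule scaleA mu scaleM l r"
    and "hochschild_2_cocycle scaleA mu scaleM l r H"
    and "twisted_rota_baxter scaleA mu scaleM l r H T"
  shows "cohomology_isomorphic
           (scale_fun scaleA) (multilinear_maps scaleM scaleA)
             (rb_differential scaleA mu scaleM l r H T)
           (scale_fun scaleA) (multilinear_maps scaleM scaleA)
             (hochschild_differential scaleA (twisted_product l r H T)
                (twisted_left_action mu r H T) (twisted_right_action mu l H T))"
proof (rule cohomology_isomorphicI_sign)
  interpret twisted_rota_baxter scaleA mu scaleM l r H T by (rule assms(4))
  fix n and f :: "'m list \<Rightarrow> 'a"
  assume f: "f \<in> multilinear_maps scaleM scaleA n"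
  show "- f \<in> multilinear_maps scaleM scaleA n"
    using f by (rule multilinear_maps_uminus)
  show "hochschild_differential scaleA star lT rT n (- f)
      = - hochschild_differential scaleA star lT rT n f"
    by (rule hochschild_differential_uminus)
  show "rb_differential scaleA mu scaleM l r H T n f
      = (if even n then hochschild_differential scaleA star lT rT n f
         else - hochschild_differential scaleA star lT rT n f)"
    using rb_differential_eq_hochschild_differential[OF assms(4) f]
    by (simp add: fun_eq_iff scale_fun_def)
qed

end
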